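(* Let $J$ be a proper homogeneous ideal in $\mathcal P=\mathbb K[x_0,\ldots,x_n]$ represented by a function $\mathrm{ComputeBasis}_J$, and let $s\in\mathbb N$. Then the algorithm BorderBasisWithComplement, with input $\mathrm{ComputeBasis}_J$ and $s$, constructs a complement $\{\mathcal N_0,\ldots,\mathcal N_s\}$ of $J$ up to degree $s$ and the associated border basis $\mathcal B_1\cup\ldots\cup\mathcal B_s$ of $J$ up to degree $s$.
   Context: $\mathbb K$ is an algebraically closed field; $\mathcal P=\mathbb K[x_0,\ldots,x_n]$; $\mathcal T_k$ is the set of monomials of degree $k$ and $\mathcal P_k$ is its $\mathbb K$-span; for a homogeneous ideal $J$, $J_k=J\cap\mathcal P_k$. For $S\subset\mathcal P_k$, $\langle S\rangle$ denotes the $\mathbb K$-span of $S$ and $S^+=\bigcup_{j=0}^n x_jS\subset\mathcal P_{k+1}$. Complement: a family $\mathcal N=\{\mathcal N_0,\ldots,\mathcal N_s\}$ is a complement of $J$ up to degree $s$ if $\mathcal N_0=\{1\}$ and, for each $k=1,\ldots,s$, $\mathcal N_k\subseteq\mathcal T_k$ is a set of monomials with $\mathcal N_k\subset\mathcal N_{k-1}^+$ and $\mathcal P_k=J_k\oplus\langle\mathcal N_k\rangle$. Border basis: let $(\partial\mathcal N)_k=\mathcal N_{k-1}^+\setminus\mathcal N_k$. For $m\in(\partial\mathcal N)_k$ let $\psi(m)$ be the unique polynomial in $\langle\mathcal N_k\rangle$ with $m+\psi(m)\in J_k$. Let $\mathcal B_k=\{m+\psi(m) : m\in(\partial\mathcal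 N)_k\}$; then $\mathcal B_1\cup\ldots\cup\mathcal B_s$ is the border basis of $J$ up to degree $s$ associated to $\mathcal N$. $J$ is represented by a function $\mathrm{ComputeBasis}_J$ if, for every finite set $N$ of monomials of the same degree, $\mathrm{ComputeBasis}_J(N)$ returns a basis of the vector space $J\cap\langle N\rangle$. Algorithm BorderBasisWithComplement. Set $\mathcal N_0=\{1\}$. For $k=1,\ldots,s$: form the set of distinct monomials $\mathcal N_{k-1}^+=\{x_im : 0\le i\le n,\ m\in\mathcal N_{k-1}\}=\{m_1,\ldots,m_t\}$; let $\mathcal V_k=\mathrm{ComputeBasis}_J(\mathcal N_{k-1}^+)$ and $q=|\mathcal V_k|$; let $A$ be the $q\times t$ matrix whose rows are the coefficient vectors of the elements of $\mathcal V_k$ with respect to $m_1,\ldots,m_t$; let $E=(e_{i,j})$ be the completely reduced row echelon form of $A$ (each pivot equals $1$ and is the only nonzero entry of its column) and let $\Sigma$ be the set of indices of the columns containing the pivots of $E$; set $\mathcal N_k=\{m_j : j\notin\Sigma\}$ and $\mathcal B_k=\{\sum_j e_{i,j}m_j : i=1,\ldots,q\}$. Output $\{\mathcal N_0,\ldots,\mathcal N_s\}$ and $\{\mathcal B_1,\ldots,\mathcal B_s\}$. *)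

theory Defs
  imports
    "HOL-Library.Poly_Mapping"
    "HOL-Computational_Algebra.Polynomial"
    "Jordan_Normal_Form.Gauss_Jordan_Elimination"
begin

text \<open>The polynomial ring in finitely many variables \<open>x\<^sub>i\<close>, where \<open>i\<close> ranges over a finite type \<open>'v\<close>
  (so \<open>CARD('v) = n + 1\<close>): a polynomial maps exponent vectors to coefficients.\<close>

type_synonym ('v, 'k) mpoly = "('v \<Rightarrow>\<^sub>0 nat) \<Rightarrow>\<^sub>0 'k"

definition mscale :: "'k \<Rightarrow> ('v::finite, 'k::field) mpoly \<Rightarrow> ('v, 'k) mpoly" where
  "mscale c p = Poly_Mapping.single 0 c * p"

definition var :: "'v \<Rightarrow> ('v::finite, 'k::field) mpoly" where
  "var i = Poly_Mapping.single (Poly_Mapping.single i 1) 1"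

text \<open>\<open>lin\<close> is linear algebra over the ground field, \<open>idl\<close> is the polynomial ring as a module over
  itself; thus \<open>lin.span\<close> is the \<open>\<bbbK>\<close>-span and \<open>idl.span\<close> is the ideal generated by a set.\<close>

global_interpretation lin: vector_space
  "mscale :: 'k::field \<Rightarrow> ('v::finite, 'k) mpoly \<Rightarrow> ('v, 'k) mpoly"
  by unfold_locales
    (simp_all add: mscale_def algebra_simps single_add mult_single flip: mult.assoc)

global_interpretation idl: Modules.module
  "(*) :: ('v::finite, 'k::field) mpoly \<Rightarrow> ('v, 'k) mpoly \<Rightarrow> ('v, 'k) mpoly"
  by unfold_locales (simp_all add: algebra_simps)

definition monomials :: "nat \<Rightarrow> ('v::finite, 'k::field) mpoly set" where
  "monomials k = {Poly_Mapping.single e 1 | e. (\<Sum>i\<in>UNIV. Poly_Mapping.lookup e i) = k}"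

definition forms :: "nat \<Rightarrow> ('v::finite, 'k::field) mpoly set" where
  "forms k = lin.span (monomials k)"

definition homogeneous_ideal :: "('v::finite, 'k::field) mpoly set \<Rightarrow> bool" where
  "homogeneous_ideal J \<longleftrightarrow> (\<exists>S. S \<subseteq> (\<Union>k. forms k) \<and> J = idl.span S)"

definition graded_part :: "('v::finite, 'k::field) mpoly set \<Rightarrow> nat \<Rightarrow> ('v, 'k) mpoly set" where
  "graded_part J k = J \<inter> forms k"

definition plus_set :: "('v::finite, 'k::field) mpoly set \<Rightarrow> ('v, 'k) mpoly set" where
  "plus_set S = (\<Union>i. (\<lambda>p. var i * p) ` S)"

definition internal_direct_sum ::
  "('v::finite, 'k::field) mpoly set \<Rightarrow> ('v, 'k) mpoly set \<Rightarrow> ('v, 'k) mpoly set \<Rightarrow> bool" where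
  "internal_direct_sum W U V \<longleftrightarrow> W = {u + v | u v. u \<in> U \<and> v \<in> V} \<and> U \<inter> V = {0}"

definition is_complement ::
  "('v::finite, 'k::field) mpoly set \<Rightarrow> nat \<Rightarrow> (nat \<Rightarrow> ('v, 'k) mpoly set) \<Rightarrow> bool" where
  "is_complement J s N \<longleftrightarrow> N 0 = {1} \<and>
     (\<forall>k\<in>{1..s}. N k \<subseteq> monomials k \<and> N k \<subseteq> plus_set (N (k - 1)) \<and>
        internal_direct_sum (forms k) (graded_part J k) (lin.span (N k)))"

definition border :: "(nat \<Rightarrow> ('v::finite, 'k::field) mpoly set) \<Rightarrow> nat \<Rightarrow> ('v, 'k) mpoly set" where
  "border N k = plus_set (N (k - 1)) - N k"

text \<open>\<open>psi\<close> and everything built on it is meaningful only when \<open>N\<close> is a complement of \<open>J\<close>.\<close>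

definition psi :: "('v::finite, 'k::field) mpoly set \<Rightarrow> (nat \<Rightarrow> ('v, 'k) mpoly set) \<Rightarrow> nat \<Rightarrow>
    ('v, 'k) mpoly \<Rightarrow> ('v, 'k) mpoly" where
  "psi J N k m = (THE p. p \<in> lin.span (N k) \<and> m + p \<in> graded_part J k)"

definition border_basis_part :: "('v::finite, 'k::field) mpoly set \<Rightarrow>
    (nat \<Rightarrow> ('v, 'k) mpoly set) \<Rightarrow> nat \<Rightarrow> ('v, 'k) mpoly set" where
  "border_basis_part J N k = (\<lambda>m. m + psi J N k m) ` border N k"

definition border_basis :: "('v::finite, 'k::field) mpoly set \<Rightarrow> nat \<Rightarrow>
    (nat \<Rightarrow> ('v, 'k) mpoly set) \<Rightarrow> ('v, 'k) mpoly set" where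
  "border_basis J s N = (\<Union>k\<in>{1..s}. border_basis_part J N k)"

definition is_basis_of :: "('v::finite, 'k::field) mpoly set \<Rightarrow> ('v, 'k) mpoly set \<Rightarrow> bool" where
  "is_basis_of B W \<longleftrightarrow> lin.independent B \<and> lin.span B = W"

definition represented_by :: "('v::finite, 'k::field) mpoly set \<Rightarrow>
    (('v, 'k) mpoly set \<Rightarrow> ('v, 'k) mpoly set) \<Rightarrow> bool" where
  "represented_by J compute_basis \<longleftrightarrow>
     (\<forall>N k. finite N \<and> N \<subseteq> monomials k \<longrightarrow> is_basis_of (compute_basis N) (J \<inter> lin.span N))"

text \<open>The algorithm lists the monomials \<open>m\<^sub>1, \<dots>, m\<^sub>t\<close> (columns) and the elements of the computed
  basis (rows) in an unspecified order. The functions \<open>ec\<close> and \<open>er\<close> below are these choices.\<close>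

definition enumerates :: "('a set \<Rightarrow> 'a list) \<Rightarrow> bool" where
  "enumerates enum \<longleftrightarrow> (\<forall>A. finite A \<longrightarrow> distinct (enum A) \<and> set (enum A) = A)"

definition coeff_matrix ::
  "('v::finite, 'k::field) mpoly list \<Rightarrow> ('v, 'k) mpoly list \<Rightarrow> 'k mat" where
  "coeff_matrix vs ms =
     mat (length vs) (length ms) (\<lambda>(i, j). lin.representation (set ms) (vs ! i) (ms ! j))"

text \<open>\<open>gauss_jordan_single\<close> computes the completely reduced row echelon form, and
  \<open>pivot_positions\<close> its list of pairs (pivot row, pivot column).\<close>

definition border_basis_step ::
  "(('v::finite, 'k::field) mpoly set \<Rightarrow> ('v, 'k) mpoly list) \<Rightarrow>
   (('v, 'k) mpoly set \<Rightarrow> ('v, 'k) mpoly list) \<Rightarrow>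
   (('v, 'k) mpoly set \<Rightarrow> ('v, 'k) mpoly set) \<Rightarrow>
   ('v, 'k) mpoly set \<Rightarrow> ('v, 'k) mpoly set \<times> ('v, 'k) mpoly set" where
  "border_basis_step ec er compute_basis N =
    (let ms = ec (plus_set N);
         vs = er (compute_basis (plus_set N));
         t = length ms;
         q = length vs;
         E = gauss_jordan_single (coeff_matrix vs ms);
         \<Sigma> = snd ` set (pivot_positions E)
     in ({ms ! j | j. j < t \<and> j \<notin> \<Sigma>},
         {\<Sum>j<t. mscale (E $$ (i, j)) (ms ! j) | i. i < q}))"

text \<open>The result consists of the lists \<open>[N\<^sub>0, \<dots>, N\<^sub>s]\<close> and \<open>[B\<^sub>1, \<dots>, B\<^sub>s]\<close>.\<close>

primrec border_basis_with_complement ::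
  "(('v::finite, 'k::field) mpoly set \<Rightarrow> ('v, 'k) mpoly list) \<Rightarrow>
   (('v, 'k) mpoly set \<Rightarrow> ('v, 'k) mpoly list) \<Rightarrow>
   (('v, 'k) mpoly set \<Rightarrow> ('v, 'k) mpoly set) \<Rightarrow> nat \<Rightarrow>
   ('v, 'k) mpoly set list \<times> ('v, 'k) mpoly set list" where
  "border_basis_with_complement ec er compute_basis 0 = ([{1}], [])"
| "border_basis_with_complement ec er compute_basis (Suc k) =
    (let (Ns, Bs) = border_basis_with_complement ec er compute_basis k;
         (N, B) = border_basis_step ec er compute_basis (last Ns)
     in (Ns @ [N], Bs @ [B]))"

end

theory Submission
  imports Defs
begin

text \<open>One step of the algorithm is linear algebra in the finite-dimensional space \<open>V\<close> spanned by the
  set \<open>M\<close> of monomials \<open>x\<^sub>i m\<close> with \<open>m \<in> N\<^sub>k\<close>. Row reduction replaces the computed basis of \<open>J \<inter> V\<close> by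
  a basis whose coordinates at the pivot monomials form an identity matrix
  (\<open>gauss_jordan_reduced_basis\<close>): there are no zero rows since the basis that was computed is
  independent. Clearing pivot coordinates then shows that \<open>V\<close> is the direct sum of \<open>J \<inter> V\<close> and the
  span of the set \<open>N\<^sub>k\<^sub>+\<^sub>1\<close> of non-pivot monomials (\<open>reduced_family_direct_sum\<close>), and each reduced basis vector is its pivot monomial plus an
  element of that span (\<open>reduced_family_tail\<close>).

  The ideal property carries this from \<open>V\<close> to all forms of degree \<open>k + 1\<close>
  (\<open>direct_sum_forms_Suc\<close>): if the forms of degree \<open>k\<close> are \<open>J\<^sub>k \<oplus> \<langle>N\<^sub>k\<rangle>\<close>, then multiplication by the
  variables shows that the forms of degree \<open>k + 1\<close> lie in \<open>J + V\<close>, and \<open>V = (J \<inter> V) \<oplus> \<langle>N\<^sub>k\<^sub>+\<^sub>1\<rangle>\<close>. The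
  induction starts in degree 0 because a proper ideal contains no nonzero constant. Finally, the
  border in degree \<open>k + 1\<close> is exactly the set of pivot monomials, and the uniqueness of \<open>\<psi>\<close>,
  which is the trivial intersection in the direct sum, identifies the rows of the reduced matrix
  with the border basis.\<close>

section \<open>Coordinates in a vector space\<close>

context vector_space
begin

lemma representation_list_combination:
  assumes "independent (set ms)" and "distinct ms" and "l < length ms"
  shows "representation (set ms) (\<Sum>j<length ms. scale (c j) (ms ! j)) (ms ! l) = c l"
proof -
  have in_span: "scale (c j) (ms ! j) \<in> span (set ms)" if "j < length ms" for j
    using that by (intro span_scale span_base) simp
  have "representation (set ms) (\<Sum>j<length ms. scale (c j) (ms ! j)) (ms ! l) =
      (\<Sum>j<length ms. representation (set ms) (scale (c j) (ms ! j)) (ms ! l))"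
    using assms(1) in_span by (subst representation_sum) auto
  also have "\<dots> = (\<Sum>j<length ms. if j = l then c j else 0)"
    using assms
    by (intro sum.cong)
      (auto simp: representation_scale[OF assms(1)] span_base representation_basis
        nth_eq_iff_index_eq)
  also have "\<dots> = c l"
    using assms(3) by simp
  finally show ?thesis .
qed

lemma list_combination_representation:
  assumes "independent (set ms)" and "distinct ms" and "v \<in> span (set ms)"
  shows "(\<Sum>j<length ms. scale (representation (set ms) v (ms ! j)) (ms ! j)) = v"
proof -
  have "(\<Sum>j<length ms. scale (representation (set ms) v (ms ! j)) (ms ! j)) =
      (\<Sum>b\<in>set ms. scale (representation (set ms) v b) b)"
    using bij_betw_nth[OF assms(2) refl refl]
    by (rule sum.reindex_bij_betw[where g = "\<lambda>b. scale (representation (set ms) v b) b"])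
  also have "\<dots> = v"
    using assms by (intro sum_representation_eq) auto
  finally show ?thesis .
qed

lemma in_span_if_coordinates_vanish:
  assumes "independent M" and "finite M" and "x \<in> span M"
    and "\<And>m. m \<in> M - N \<Longrightarrow> representation M x m = 0"
  shows "x \<in> span N"
proof -
  have "x = (\<Sum>m\<in>M. scale (representation M x m) m)"
    using assms(1-3) by (intro sum_representation_eq[symmetric]) auto
  also have "\<dots> \<in> span N"
  proof (rule span_sum)
    fix m
    assume "m \<in> M"
    then show "scale (representation M x m) m \<in> span N"
      using assms(4)[of m] by (cases "m \<in> N") (auto intro: span_scale span_base span_zero)
  qed
  finally show ?thesis .
qed

lemma coordinate_eq_0_if_in_span:
  assumes "independent M" and "N \<subseteq> M" and "x \<in> span N" and "m \<notin> N"
  shows "representation M x m = 0"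
  using representation_extend[OF assms(1,3,2)] representation_ne_zero[of N x m] assms(4) by auto

text \<open>In the next three lemmas the family \<open>b\<close> plays the rows of a reduced echelon form and \<open>p\<close> its
  pivots: the pivot coordinates of the \<open>b i\<close> form an identity matrix. In particular the pivot
  coordinates of \<open>b i\<close> and \<open>p i\<close> agree, so their difference has none.\<close>

lemma reduced_family_tail:
  assumes "independent M" and "finite M"
    and "\<And>i. i \<in> I \<Longrightarrow> b i \<in> span M" and "p ` I \<subseteq> M"
    and "\<And>i i'. i \<in> I \<Longrightarrow> i' \<in> I \<Longrightarrow> representation M (b i) (p i') = (if i' = i then 1 else 0)"
    and "i \<in> I"
  shows "b i - p i \<in> span (M - p ` I)"
proof (rule in_span_if_coordinates_vanish[OF assms(1,2)])
  have p_span: "p i \<in> span M"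
    using assms(4,6) by (intro span_base) auto
  then show "b i - p i \<in> span M"
    using assms(3,6) by (intro span_diff) auto
  have p_inj: "p i' = p i \<longleftrightarrow> i' = i" if "i' \<in> I" for i'
    using assms(5)[of i i'] assms(5)[of i i] assms(6) that by (auto split: if_splits)
  fix m
  assume "m \<in> M - (M - p ` I)"
  then obtain i' where i': "i' \<in> I" "m = p i'"
    by auto
  have "representation M (p i) (p i') = (if p i' = p i then 1 else 0)"
    using assms(4,6) representation_basis[OF assms(1), of "p i"] by auto
  then show "representation M (b i - p i) m = 0"
    using i' p_inj assms(3,5,6) p_span by (simp add: representation_diff[OF assms(1)])
qed

text \<open>Both sides are linear in \<open>x\<close> and agree on each \<open>b i\<close>. Thus an element of the span of the
  family is determined by its pivot coordinates.\<close>

lemma reduced_family_span: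
  assumes "independent M" and "finite I"
    and "\<And>i. i \<in> I \<Longrightarrow> b i \<in> span M"
    and "\<And>i i'. i \<in> I \<Longrightarrow> i' \<in> I \<Longrightarrow> representation M (b i) (p i') = (if i' = i then 1 else 0)"
    and "x \<in> span (b ` I)"
  shows "x = (\<Sum>i\<in>I. scale (representation M x (p i)) (b i))"
proof -
  have sub: "span (b ` I) \<subseteq> span M"
    using assms(3) by (intro span_minimal subspace_span) auto
  have "x \<in> span (b ` I) \<and> x = (\<Sum>i\<in>I. scale (representation M x (p i)) (b i))"
    using assms(5)
  proof (induction rule: span_induct_alt)
    case base
    show ?case
      by (simp add: span_zero representation_zero)
  next
    case (step c y z)
    then obtain i where i: "i \<in> I" "y = b i"
      by auto
    have "representation M (scale c y + z) (p i') =
        (if i' = i then c else 0) + representation M z (p i')" if "i' \<in> I" for i'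
      using that i step sub assms(3,4)
      by (auto simp: representation_add[OF assms(1)] representation_scale[OF assms(1)] span_scale)
    then have "(\<Sum>i'\<in>I. scale (representation M (scale c y + z) (p i')) (b i')) =
        (\<Sum>i'\<in>I. scale (if i' = i then c else 0) (b i')) +
        (\<Sum>i'\<in>I. scale (representation M z (p i')) (b i'))"
      by (simp add: scale_left_distrib sum.distrib)
    also have "(\<Sum>i'\<in>I. scale (if i' = i then c else 0) (b i')) = scale c y"
      using i assms(2) by (simp add: if_distrib[of "\<lambda>c. scale c _"] cong: if_cong)
    finally show ?case
      using step i by (auto intro: span_add span_scale span_base)
  qed
  then show ?thesis ..
qed

text \<open>Subtracting the combination of the \<open>b i\<close> with the same pivot coordinates clears the pivot
  coordinates of a vector, which gives the sum. A vector in the intersection has zero pivot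
  coordinates and is a combination of the \<open>b i\<close> with these coordinates as coefficients.\<close>

lemma reduced_family_direct_sum:
  assumes "independent M" and "finite M" and "finite I"
    and "\<And>i. i \<in> I \<Longrightarrow> b i \<in> span M" and "p ` I \<subseteq> M"
    and "\<And>i i'. i \<in> I \<Longrightarrow> i' \<in> I \<Longrightarrow> representation M (b i) (p i') = (if i' = i then 1 else 0)"
  shows "span M = {u + v | u v. u \<in> span (b ` I) \<and> v \<in> span (M - p ` I)}"
    and "span (b ` I) \<inter> span (M - p ` I) = {0}"
proof -
  let ?N = "M - p ` I"
  have sub: "span (b ` I) \<subseteq> span M"
    using assms(4) by (intro span_minimal subspace_span) auto
  have "x \<in> {u + v | u v. u \<in> span (b ` I) \<and> v \<in> span ?N}" if x: "x \<in> span M" for x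
  proof -
    define u where "u = (\<Sum>i\<in>I. scale (representation M x (p i)) (b i))"
    have u: "u \<in> span (b ` I)"
      unfolding u_def by (intro span_sum span_scale span_base) auto
    have pivots: "representation M (x - u) (p i) = 0" if "i \<in> I" for i
    proof -
      have "representation M u (p i) =
          (\<Sum>i'\<in>I. representation M (scale (representation M x (p i')) (b i')) (p i))"
        unfolding u_def using assms(1,4) by (subst representation_sum) (auto intro: span_scale)
      also have "\<dots> = (\<Sum>i'\<in>I. if i' = i then representation M x (p i') else 0)"
        using that assms(4,6) by (intro sum.cong) (auto simp: representation_scale[OF assms(1)])
      also have "\<dots> = representation M x (p i)"
        using that assms(3) by simp
      finally show ?thesis
        using x u sub by (subst representation_diff[OF assms(1)]) auto
    qed
    have "x - u \<in> span M"
      using x u sub by (intro span_diff) auto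
    then have "x - u \<in> span ?N"
      by (rule in_span_if_coordinates_vanish[OF assms(1,2)]) (use pivots in auto)
    then show ?thesis
      using u by (intro CollectI exI[of _ u] exI[of _ "x - u"]) simp
  qed
  moreover have "u + v \<in> span M" if "u \<in> span (b ` I)" and "v \<in> span ?N" for u v
    using that sub span_mono[of ?N M] by (intro span_add) auto
  ultimately show "span M = {u + v | u v. u \<in> span (b ` I) \<and> v \<in> span ?N}"
    by blast
  have "x = 0" if "x \<in> span (b ` I)" and "x \<in> span ?N" for x
  proof -
    have "representation M x (p i) = 0" if "i \<in> I" for i
      using that \<open>x \<in> span ?N\<close> by (intro coordinate_eq_0_if_in_span[OF assms(1), of ?N]) auto
    then show ?thesis
      using reduced_family_span[OF assms(1,3,4,6) \<open>x \<in> span (b ` I)\<close>] by simp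
  qed
  then show "span (b ` I) \<inter> span ?N = {0}"
    by (auto intro: span_zero)
qed

section \<open>Row reduction of a coefficient matrix\<close>

text \<open>Turning matrix rows into vectors commutes with row operations, so an invertible matrix of row
  operations does not change the span of the row vectors.\<close>

lemma row_combination_mult:
  assumes "P \<in> carrier_mat q r" and "A \<in> carrier_mat r t" and "i < q"
  shows "(\<Sum>j<t. scale ((P * A) $$ (i, j)) (m j)) =
    (\<Sum>l<r. scale (P $$ (i, l)) (\<Sum>j<t. scale (A $$ (l, j)) (m j)))"
proof -
  have "(P * A) $$ (i, j) = (\<Sum>l<r. P $$ (i, l) * A $$ (l, j))" if "j < t" for j
    using that assms by (simp add: scalar_prod_def atLeast0LessThan)
  then have "(\<Sum>j<t. scale ((P * A) $$ (i, j)) (m j)) =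
      (\<Sum>j<t. \<Sum>l<r. scale (P $$ (i, l) * A $$ (l, j)) (m j))"
    by (simp add: scale_sum_left)
  also have "\<dots> = (\<Sum>l<r. \<Sum>j<t. scale (P $$ (i, l) * A $$ (l, j)) (m j))"
    by (rule sum.swap)
  finally show ?thesis
    by (simp add: scale_sum_right)
qed

text \<open>Elimination multiplies the matrix by an invertible matrix \<open>P\<close>, so the new rows span the same
  space. A zero row would make a row of \<open>P\<close> a linear relation between the independent vectors
  \<open>vs\<close>; that row of \<open>P\<close> would vanish, contradicting invertibility. Hence every row has a pivot.\<close>

lemma gauss_jordan_reduced_basis:
  fixes A :: "'a mat"
  assumes ms: "independent (set ms)" "distinct ms"
    and vs: "independent (set vs)" "distinct vs" "set vs \<subseteq> span (set ms)"
    and A: "A = mat (length vs) (length ms)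
      (\<lambda>(i, j). representation (set ms) (vs ! i) (ms ! j))"
  defines "E \<equiv> gauss_jordan_single A"
  defines "b \<equiv> \<lambda>i. \<Sum>j<length ms. scale (E $$ (i, j)) (ms ! j)"
  obtains f where "snd ` set (pivot_positions E) = f ` {..<length vs}"
    and "f ` {..<length vs} \<subseteq> {..<length ms}"
    and "\<And>i i'. i < length vs \<Longrightarrow> i' < length vs \<Longrightarrow>
      representation (set ms) (b i) (ms ! f i') = (if i' = i then 1 else 0)"
    and "span (b ` {..<length vs}) = span (set vs)"
proof -
  let ?q = "length vs" and ?t = "length ms"
  have carrier_A: "A \<in> carrier_mat ?q ?t"
    by (simp add: A)
  note gj = gauss_jordan_single[OF carrier_A E_def[symmetric, THEN meta_eq_to_obj_eq]]
  from gj(4) obtain P Q where PQ: "E = P * A" "P \<in> carrier_mat ?q ?q" "Q \<in> carrier_mat ?q ?q"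
      "P * Q = 1\<^sub>m ?q" "Q * P = 1\<^sub>m ?q"
    by blast
  have "Q * E = A"
    using PQ carrier_A by (simp flip: assoc_mult_mat)
  have v_eq: "(\<Sum>j<?t. scale (A $$ (l, j)) (ms ! j)) = vs ! l" if "l < ?q" for l
  proof -
    have "vs ! l \<in> span (set ms)"
      using that vs(3) by auto
    then show ?thesis
      using that list_combination_representation[OF ms] by (simp add: A)
  qed
  have b_eq: "b i = (\<Sum>l<?q. scale (P $$ (i, l)) (vs ! l))" if "i < ?q" for i
    using row_combination_mult[OF PQ(2) carrier_A that, of "(!) ms"] v_eq
    by (simp add: b_def PQ(1))
  have vb: "vs ! l = (\<Sum>i<?q. scale (Q $$ (l, i)) (b i))" if "l < ?q" for l
    using row_combination_mult[OF PQ(3) gj(2) that, of "(!) ms"] v_eq[OF that]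
    by (simp add: b_def \<open>Q * E = A\<close>)
  have span_eq: "span (b ` {..<?q}) = span (set vs)"
  proof (intro subset_antisym span_minimal subspace_span)
    show "b ` {..<?q} \<subseteq> span (set vs)"
      by (auto simp: b_eq intro!: span_sum span_scale intro: span_base)
    show "set vs \<subseteq> span (b ` {..<?q})"
      unfolding in_set_conv_nth subset_iff
      using vb by (force intro!: span_sum span_scale intro: span_base)
  qed
  have b_ne_0: "b i \<noteq> 0" if i: "i < ?q" for i
  proof
    assume "b i = 0"
    then have "P $$ (i, l) = 0" if "l < ?q" for l
      using representation_list_combination[OF vs(1,2) that, of "\<lambda>l. P $$ (i, l)"] b_eq[OF i]
      by (simp add: representation_zero)
    then have "(P * Q) $$ (i, i) = 0"
      using i PQ(2,3) by (simp add: scalar_prod_def)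
    then show False
      using i PQ(4) by simp
  qed
  from gj(2,3) obtain f where f: "pivot_fun E f ?t"
    by (auto simp: row_echelon_form_def)
  have "dim_row E = ?q"
    using gj(2) by simp
  note pivot = pivot_funD[OF this f]
  have f_less: "f i < ?t" if "i < ?q" for i
  proof (rule ccontr)
    \<comment> \<open>A pivot function marks rows without pivot by the column number \<open>length ms\<close>; such rows
      are zero.\<close>
    assume "\<not> f i < ?t"
    then have "b i = 0"
      unfolding b_def by (intro sum.neutral ballI) (use pivot(2)[OF that] in auto)
    then show False
      using b_ne_0[OF that] by simp
  qed
  show ?thesis
  proof (rule that)
    show "snd ` set (pivot_positions E) = f ` {..<?q}"
      unfolding pivot_positions(1)[OF gj(2) f] using f_less by force
    show "f ` {..<?q} \<subseteq> {..<?t}"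
      using f_less by auto
    show "span (b ` {..<?q}) = span (set vs)"
      by (rule span_eq)
    fix i i'
    assume "i < ?q" "i' < ?q"
    then show "representation (set ms) (b i) (ms ! f i') = (if i' = i then 1 else 0)"
      unfolding b_def using pivot(4,5)[of i'] f_less[of i']
      by (subst representation_list_combination[OF ms]) auto
  qed
qed

end

section \<open>Monomials and forms\<close>

lemma direct_sum_decompose:
  assumes "internal_direct_sum W U V" and "x \<in> W"
  obtains u v where "x = u + v" and "u \<in> U" and "v \<in> V"
  using assms unfolding internal_direct_sum_def by blast

lemma lookup_mscale: "Poly_Mapping.lookup (mscale c p) e = c * Poly_Mapping.lookup p e"
  unfolding mscale_def mult_map_scale_conv_mult[symmetric]
  by (auto simp: Poly_Mapping.map.rep_eq when_def)

lemma independent_monomials: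
  "lin.independent (monomials k :: ('v::finite, 'k::field) mpoly set)"
proof (unfold lin.independent_explicit_module, intro allI impI)
  fix t and u :: "('v, 'k) mpoly \<Rightarrow> 'k" and v
  assume t: "finite t" "t \<subseteq> monomials k" and sum_0: "(\<Sum>v\<in>t. mscale (u v) v) = 0" and "v \<in> t"
  then obtain e where e: "v = Poly_Mapping.single e 1"
    by (auto simp: monomials_def)
  have "Poly_Mapping.lookup w e = (if w = v then 1 else 0)" if "w \<in> t" for w
    using that t(2) by (auto simp: e monomials_def lookup_single when_def)
  then have "Poly_Mapping.lookup (\<Sum>v\<in>t. mscale (u v) v) e = (\<Sum>w\<in>t. if w = v then u w else 0)"
    by (auto simp: lookup_sum lookup_mscale intro!: sum.cong)
  also have "\<dots> = u v"
    using t(1) \<open>v \<in> t\<close> by simp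
  finally show "u v = 0"
    using sum_0 by simp
qed

lemma var_times_monomial:
  assumes "m \<in> monomials k"
  shows "var i * m \<in> monomials (Suc k)"
proof -
  from assms obtain e where "m = Poly_Mapping.single e 1" "(\<Sum>i\<in>UNIV. Poly_Mapping.lookup e i) = k"
    by (auto simp: monomials_def)
  then show ?thesis
    by (auto simp: monomials_def var_def mult_single lookup_add lookup_single sum.distrib when_def
        intro!: exI[of _ "Poly_Mapping.single i 1 + e"])
qed

lemma monomials_Suc:
  "monomials (Suc k) = plus_set (monomials k :: ('v::finite, 'k::field) mpoly set)"
    (is "?L = ?R")
proof (rule subset_antisym)
  show "?R \<subseteq> ?L"
    by (auto simp: plus_set_def var_times_monomial)
  show "?L \<subseteq> ?R"
  proof
    fix m :: "('v, 'k) mpoly"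
    assume "m \<in> ?L"
    then obtain e where e: "m = Poly_Mapping.single e 1"
        "(\<Sum>i\<in>UNIV. Poly_Mapping.lookup e i) = Suc k"
      by (auto simp: monomials_def)
    then obtain i where i: "Poly_Mapping.lookup e i > 0"
      by (metis gr0I nat.distinct(1) sum.neutral)
    define e' where "e' = e - Poly_Mapping.single i 1"
    have e_eq: "e = Poly_Mapping.single i 1 + e'"
      using i by (intro poly_mapping_eqI) (auto simp: e'_def lookup_add lookup_minus lookup_single when_def)
    have "(\<Sum>i\<in>UNIV. Poly_Mapping.lookup e' i) = k"
      using e(2) by (simp add: e_eq lookup_add lookup_single sum.distrib when_def)
    then have "Poly_Mapping.single e' 1 \<in> (monomials k :: ('v, 'k) mpoly set)"
      by (auto simp: monomials_def)
    moreover have "m = var i * Poly_Mapping.single e' 1"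
      by (simp add: e(1) e_eq var_def mult_single)
    ultimately show "m \<in> ?R"
      by (auto simp: plus_set_def)
  qed
qed

lemma monomials_0: "monomials 0 = {1 :: ('v::finite, 'k::field) mpoly}"
proof -
  have "(\<Sum>i\<in>UNIV. Poly_Mapping.lookup e i) = 0 \<longleftrightarrow> e = 0" for e :: "'v::finite \<Rightarrow>\<^sub>0 nat"
    by (auto intro: poly_mapping_eqI)
  then show ?thesis
    by (simp add: monomials_def)
qed

lemma plus_set_mono: "S \<subseteq> T \<Longrightarrow> plus_set S \<subseteq> plus_set T"
  by (auto simp: plus_set_def)

lemma finite_plus_set: "finite S \<Longrightarrow> finite (plus_set S)"
  by (simp add: plus_set_def)

lemma var_times_span:
  assumes "p \<in> lin.span S"
  shows "var i * p \<in> lin.span (plus_set S)"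
  using assms
proof (induction rule: lin.span_induct_alt)
  case base
  show ?case
    by (simp add: lin.span_zero)
next
  case (step c x y)
  have "var i * (mscale c x + y) = mscale c (var i * x) + var i * y"
    by (simp add: mscale_def distrib_left mult.left_commute)
  moreover have "var i * x \<in> lin.span (plus_set S)"
    using step by (intro lin.span_base) (auto simp: plus_set_def)
  ultimately show ?case
    using step by (simp add: lin.span_add lin.span_scale)
qed

lemma ideal_is_linear_subspace:
  assumes "idl.subspace J"
  shows "lin.subspace J"
  using idl.subspace_0[OF assms] idl.subspace_add[OF assms] idl.subspace_scale[OF assms]
  by (auto simp: lin.subspace_def mscale_def)

text \<open>Existence of the sum is inherited from degree \<open>k\<close> because every monomial of degree \<open>Suc k\<close>
  is a variable times a monomial of degree \<open>k\<close>: multiplying the decomposition of the latter by the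
  variable gives an element of \<open>J\<close> plus an element of the span of \<open>plus_set N\<close>.\<close>

lemma forms_Suc_decompose:
  fixes J :: "('v::finite, 'k::field) mpoly set"
  assumes J: "idl.subspace J"
    and sum: "internal_direct_sum (forms k) (graded_part J k) (lin.span N)"
    and "p \<in> forms (Suc k)"
  shows "\<exists>u v. p = u + v \<and> u \<in> J \<and> v \<in> lin.span (plus_set N)"
proof -
  let ?D = "{u + v | u v. u \<in> J \<and> v \<in> lin.span (plus_set N)}"
  have D: "lin.subspace ?D"
    by (intro lin.subspace_sums lin.subspace_span ideal_is_linear_subspace[OF J])
  have "monomials (Suc k) \<subseteq> ?D"
  proof
    fix m :: "('v, 'k) mpoly"
    assume "m \<in> monomials (Suc k)"
    then obtain i m' where m: "m = var i * m'" and "m' \<in> monomials k"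
      by (auto simp: monomials_Suc plus_set_def)
    then have "m' \<in> forms k"
      by (simp add: forms_def lin.span_base)
    from direct_sum_decompose[OF sum this] obtain u v
      where "m' = u + v" "u \<in> J" "v \<in> lin.span N"
      unfolding graded_part_def by blast
    moreover from this have "var i * u \<in> J"
      using idl.subspace_scale[OF J] by auto
    ultimately show "m \<in> ?D"
      using var_times_span[of v N i] by (auto simp: m distrib_left)
  qed
  then have "forms (Suc k) \<subseteq> ?D"
    unfolding forms_def using D by (rule lin.span_minimal)
  then show ?thesis
    using assms(3) by blast
qed

text \<open>The summand in the span of \<open>plus_set N\<close> is decomposed further by the second direct sum. Both
  decompositions together give an element of \<open>J\<close>, which is itself a form because the other
  summand and the whole are forms of degree \<open>Suc k\<close>. The intersection is already trivial because
  the span of \<open>N'\<close> lies in that of \<open>plus_set N\<close>.\<close>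

lemma direct_sum_forms_Suc:
  fixes J :: "('v::finite, 'k::field) mpoly set"
  assumes J: "idl.subspace J" and N: "N \<subseteq> monomials k"
    and sum: "internal_direct_sum (forms k) (graded_part J k) (lin.span N)"
    and sum': "internal_direct_sum (lin.span (plus_set N)) (J \<inter> lin.span (plus_set N)) (lin.span N')"
    and "N' \<subseteq> plus_set N"
  shows "internal_direct_sum (forms (Suc k)) (graded_part J (Suc k)) (lin.span N')"
proof -
  let ?M = "plus_set N"
  have M_forms: "lin.span ?M \<subseteq> forms (Suc k)"
    using plus_set_mono[OF N] by (simp add: forms_def monomials_Suc lin.span_mono)
  have N'_M: "lin.span N' \<subseteq> lin.span ?M"
    using assms(5) by (rule lin.span_mono)
  have forms: "lin.subspace (forms (Suc k) :: ('v, 'k) mpoly set)"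
    by (simp add: forms_def)
  note J_lin = ideal_is_linear_subspace[OF J]
  have "p \<in> {u + v | u v. u \<in> graded_part J (Suc k) \<and> v \<in> lin.span N'}" if p: "p \<in> forms (Suc k)" for p
  proof -
    obtain u v where uv: "p = u + v" "u \<in> J" "v \<in> lin.span ?M"
      using forms_Suc_decompose[OF J sum p] by blast
    from direct_sum_decompose[OF sum' uv(3)] obtain u' v'
      where uv': "v = u' + v'" "u' \<in> J" "v' \<in> lin.span N'"
      by blast
    have "v' \<in> forms (Suc k)"
      using uv' N'_M M_forms by blast
    then have "p - v' \<in> forms (Suc k)"
      using p by (rule lin.subspace_diff[OF forms, rotated])
    moreover have "p - v' \<in> J"
      using uv uv' by (simp add: lin.subspace_add[OF J_lin])
    ultimately show ?thesis
      using uv'(3) by (intro CollectI exI[of _ "p - v'"] exI[of _ v']) (simp add: graded_part_def)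
  qed
  moreover have "u + v \<in> forms (Suc k)" if "u \<in> graded_part J (Suc k)" and "v \<in> lin.span N'" for u v
    using that N'_M M_forms by (intro lin.subspace_add[OF forms]) (auto simp: graded_part_def)
  moreover have "graded_part J (Suc k) \<inter> lin.span N' = {0}"
  proof -
    have "J \<inter> lin.span ?M \<inter> lin.span N' = {0}"
      using sum' by (simp add: internal_direct_sum_def)
    then show ?thesis
      using N'_M M_forms by (auto simp: graded_part_def)
  qed
  ultimately show ?thesis
    unfolding internal_direct_sum_def by blast
qed

text \<open>The forms of degree 0 are the constants, and a nonzero constant in \<open>J\<close> would be a unit.\<close>

lemma direct_sum_forms_0:
  assumes J: "idl.subspace J" and "J \<noteq> UNIV"
  shows "internal_direct_sum (forms 0) (graded_part J 0) (lin.span {1})"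
proof -
  have "1 \<notin> J"
  proof
    assume "1 \<in> J"
    then have "p \<in> J" for p
      using idl.subspace_scale[OF J, of 1 p] by simp
    then show False
      using assms(2) by auto
  qed
  have "p = 0" if "p \<in> J" and p: "p \<in> lin.span {1}" for p
  proof (rule ccontr)
    assume "p \<noteq> 0"
    from p obtain c where c: "p = mscale c 1"
      by (auto simp: lin.span_singleton)
    then have "c \<noteq> 0"
      using \<open>p \<noteq> 0\<close> by auto
    then have "mscale (inverse c) p = 1"
      by (simp add: c)
    then show False
      using lin.subspace_scale[OF ideal_is_linear_subspace[OF J] \<open>p \<in> J\<close>, of "inverse c"] \<open>1 \<notin> J\<close>
      by simp
  qed
  moreover have "0 \<in> J"
    using idl.subspace_0[OF J] .
  ultimately have "J \<inter> lin.span {1} = {0}"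
    by (auto intro: lin.span_zero)
  then show ?thesis
    by (auto simp: internal_direct_sum_def graded_part_def forms_def monomials_0
        intro: lin.span_add \<open>0 \<in> J\<close> lin.span_zero)
qed

text \<open>Two candidates for \<open>\<psi>\<close> differ by an element of both summands.\<close>

lemma psi_eq:
  assumes sum: "internal_direct_sum (forms k) (graded_part J k) (lin.span (N k))"
    and J: "idl.subspace J"
    and "p \<in> lin.span (N k)" and "m + p \<in> graded_part J k"
  shows "psi J N k m = p"
  unfolding psi_def
proof (rule the_equality)
  show "p \<in> lin.span (N k) \<and> m + p \<in> graded_part J k"
    using assms(3,4) ..
  fix r
  assume r: "r \<in> lin.span (N k) \<and> m + r \<in> graded_part J k"
  have "lin.subspace (graded_part J k)"
    unfolding graded_part_def forms_def
    by (intro lin.subspace_inter ideal_is_linear_subspace[OF J] lin.subspace_span)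
  then have "(m + r) - (m + p) \<in> graded_part J k"
    using r assms(4) by (intro lin.subspace_diff) auto
  then have "r - p \<in> graded_part J k"
    by (simp only: add_diff_cancel_left)
  moreover have "r - p \<in> lin.span (N k)"
    using r assms(3) by (intro lin.span_diff) auto
  ultimately have "r - p \<in> graded_part J k \<inter> lin.span (N k)"
    by blast
  also have "\<dots> = {0}"
    using sum by (simp add: internal_direct_sum_def)
  finally show "r = p"
    by simp
qed

section \<open>The algorithm\<close>

text \<open>The map \<open>b\<close> sends each pivot monomial to the row of the reduced matrix that has its pivot
  there. Indexing the rows by their pivots rather than by numbers makes \<open>plus_set N - N'\<close> the
  index set, which is the border of the complement under construction.\<close>

lemma border_basis_step_correct:
  fixes J :: "('v::finite, 'k::field) mpoly set"
  assumes J: "idl.subspace J"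
    and rep: "represented_by J compute_basis"
    and enum: "enumerates ec" "enumerates er"
    and N: "finite N" "N \<subseteq> monomials k"
    and step: "border_basis_step ec er compute_basis N = (N', B)"
  obtains b where "N' \<subseteq> plus_set N"
    and "internal_direct_sum (lin.span (plus_set N)) (J \<inter> lin.span (plus_set N)) (lin.span N')"
    and "B = b ` (plus_set N - N')"
    and "\<And>m. m \<in> plus_set N - N' \<Longrightarrow> b m - m \<in> lin.span N'"
    and "\<And>m. m \<in> plus_set N - N' \<Longrightarrow> b m \<in> J"
proof -
  let ?M = "plus_set N"
  define ms where "ms = ec ?M"
  define vs where "vs = er (compute_basis ?M)"
  define E where "E = gauss_jordan_single (coeff_matrix vs ms)"
  define c where "c = (\<lambda>i. \<Sum>j<length ms. mscale (E $$ (i, j)) (ms ! j))"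
  have M: "finite ?M" "?M \<subseteq> monomials (Suc k)"
    using N plus_set_mono[OF N(2)] by (simp_all add: finite_plus_set monomials_Suc)
  have indep_M: "lin.independent ?M"
    using independent_monomials M(2) by (rule lin.independent_mono)
  have ms: "distinct ms" "set ms = ?M"
    using enum(1) M(1) by (simp_all add: enumerates_def ms_def)
  have basis: "lin.independent (compute_basis ?M)" "lin.span (compute_basis ?M) = J \<inter> lin.span ?M"
    using rep M by (auto simp: represented_by_def is_basis_of_def)
  then have basis_sub: "compute_basis ?M \<subseteq> lin.span ?M"
    using lin.span_superset[of "compute_basis ?M"] by auto
  then have "finite (compute_basis ?M)"
    using lin.independent_span_bound[OF M(1) basis(1)] by simp
  then have vs: "distinct vs" "set vs = compute_basis ?M"
    using enum(2) by (simp_all add: enumerates_def vs_def)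
  obtain f where f: "snd ` set (pivot_positions E) = f ` {..<length vs}"
      "f ` {..<length vs} \<subseteq> {..<length ms}"
      "\<And>i i'. i < length vs \<Longrightarrow> i' < length vs \<Longrightarrow>
        lin.representation ?M (c i) (ms ! f i') = (if i' = i then 1 else 0)"
      "lin.span (c ` {..<length vs}) = J \<inter> lin.span ?M"
    using lin.gauss_jordan_reduced_basis[of ms vs "coeff_matrix vs ms"]
      ms vs indep_M basis basis_sub
    unfolding E_def c_def coeff_matrix_def by auto
  define I where "I = {..<length vs}"
  define p where "p = (\<lambda>i. ms ! f i)"
  have c_J: "c i \<in> J" "c i \<in> lin.span ?M" if "i \<in> I" for i
    using lin.span_base[of "c i" "c ` {..<length vs}"] f(4) that by (auto simp: I_def)
  have p_M: "p ` I \<subseteq> ?M"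
    using f(2) by (auto simp: p_def I_def simp flip: ms(2) intro!: nth_mem)
  have "N' = {ms ! j | j. j < length ms \<and> j \<notin> f ` I}" "B = c ` I"
    using step f(1) unfolding border_basis_step_def Let_def ms_def[symmetric] vs_def[symmetric]
      E_def[symmetric] by (auto simp: c_def I_def)
  moreover have "{ms ! j | j. j < length ms \<and> j \<notin> f ` I} = ?M - p ` I"
  proof -
    have "ms ! j = ms ! f i \<longleftrightarrow> j = f i" if "j < length ms" and "i \<in> I" for i j
      using that f(2) by (intro nth_eq_iff_index_eq[OF ms(1)]) (auto simp: I_def)
    then have "ms ! j \<in> p ` I \<longleftrightarrow> j \<in> f ` I" if "j < length ms" for j
      using that by (auto simp: p_def image_iff)
    then have "{ms ! j | j. j < length ms \<and> j \<notin> f ` I} =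
        {ms ! j | j. j < length ms \<and> ms ! j \<notin> p ` I}"
      by (intro Collect_cong) (simp cong: conj_cong)
    also have "\<dots> = set ms - p ` I"
      unfolding in_set_conv_nth set_eq_iff Diff_iff mem_Collect_eq by metis
    finally show ?thesis
      by (simp add: ms(2))
  qed
  ultimately have N'_eq: "N' = ?M - p ` I" and B_eq: "B = c ` I"
    by simp_all
  have reduced: "lin.representation ?M (c i) (p i') = (if i' = i then 1 else 0)"
    if "i \<in> I" "i' \<in> I" for i i'
    using f(3) that by (simp add: p_def I_def)
  have "inj_on p I"
    by (rule inj_onI) (metis reduced zero_neq_one)
  then have inv: "the_inv_into I p (p i) = i" if "i \<in> I" for i
    using that by (rule the_inv_into_f_f)
  have border: "?M - N' = p ` I"
    using p_M by (auto simp: N'_eq)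
  show ?thesis
  proof (rule that[of "\<lambda>m. c (the_inv_into I p m)"])
    show "N' \<subseteq> ?M"
      by (auto simp: N'_eq)
    show "internal_direct_sum (lin.span ?M) (J \<inter> lin.span ?M) (lin.span N')"
      using lin.reduced_family_direct_sum[OF indep_M M(1), of I c p] c_J(2) p_M reduced f(4)
      by (simp add: internal_direct_sum_def N'_eq I_def)
    show "B = (\<lambda>m. c (the_inv_into I p m)) ` (?M - N')"
      by (simp add: B_eq border image_image inv cong: image_cong)
    fix m
    assume "m \<in> ?M - N'"
    then obtain i where i: "i \<in> I" "m = p i"
      using border by auto
    show "c (the_inv_into I p m) - m \<in> lin.span N'"
      using lin.reduced_family_tail[OF indep_M M(1) c_J(2) p_M reduced i(1)]
      by (simp add: i inv N'_eq)
    show "c (the_inv_into I p m) \<in> J"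
      using i c_J(1) by (simp add: inv)
  qed
qed

text \<open>Later iterations only append to the lists, so each entry arises from its predecessor by one
  step. The list \<open>Bs\<close> starts with degree 1, whence the shift between \<open>Ns\<close> and \<open>Bs\<close>.\<close>

lemma border_basis_with_complement_nth:
  assumes "border_basis_with_complement ec er compute_basis s = (Ns, Bs)"
  shows "length Ns = Suc s \<and> length Bs = s \<and> Ns ! 0 = {1} \<and>
    (\<forall>k<s. border_basis_step ec er compute_basis (Ns ! k) = (Ns ! Suc k, Bs ! k))"
  using assms
proof (induction s arbitrary: Ns Bs)
  case 0
  then show ?case
    by auto
next
  case (Suc s)
  obtain Ns' Bs' N B where rec: "border_basis_with_complement ec er compute_basis s = (Ns', Bs')"
      "border_basis_step ec er compute_basis (last Ns') = (N, B)"
    by (metis prod.exhaust)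
  then have eq: "Ns = Ns' @ [N]" "Bs = Bs' @ [B]"
    using Suc.prems by auto
  note IH = Suc.IH[OF rec(1)]
  then have "last Ns' = Ns' ! s"
    by (subst last_conv_nth) auto
  then show ?case
    using IH rec(2) by (auto simp: eq nth_append less_Suc_eq)
qed

theorem proposition2p9:
  fixes J :: "('v::finite, 'k::alg_closed_field) mpoly set"
    and compute_basis :: "('v, 'k) mpoly set \<Rightarrow> ('v, 'k) mpoly set"
    and ec er :: "('v, 'k) mpoly set \<Rightarrow> ('v, 'k) mpoly list"
    and s :: nat
  assumes "homogeneous_ideal J" and "J \<noteq> UNIV"
    and "represented_by J compute_basis"
    and "enumerates ec" and "enumerates er"
    and "border_basis_with_complement ec er compute_basis s = (Ns, Bs)"
  shows "length Ns = s + 1 \<and> length Bs = s \<and>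
    is_complement J s (\<lambda>k. Ns ! k) \<and>
    (\<forall>k\<in>{1..s}. Bs ! (k - 1) = border_basis_part J (\<lambda>k. Ns ! k) k) \<and>
    \<Union> (set Bs) = border_basis J s (\<lambda>k. Ns ! k)"
proof -
  let ?N = "\<lambda>k. Ns ! k"
  have J: "idl.subspace J"
    using assms(1) by (auto simp: homogeneous_ideal_def)
  have run: "length Ns = Suc s" "length Bs = s" "?N 0 = {1}"
      "\<And>k. k < s \<Longrightarrow> border_basis_step ec er compute_basis (?N k) = (?N (Suc k), Bs ! k)"
    using border_basis_with_complement_nth[OF assms(6)] by auto
  note step = border_basis_step_correct[OF J assms(3-5) _ _ run(4)]
  have invariant: "finite (?N k) \<and> ?N k \<subseteq> monomials k \<and>
      internal_direct_sum (forms k) (graded_part J k) (lin.span (?N k))" if "k \<le> s" for k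
    using that
  proof (induction k)
    case 0
    then show ?case
      using direct_sum_forms_0[OF J assms(2)] by (simp add: run(3) monomials_0)
  next
    case (Suc k)
    then have k: "k < s" and IH: "finite (?N k)" "?N k \<subseteq> monomials k"
        "internal_direct_sum (forms k) (graded_part J k) (lin.span (?N k))"
      by auto
    obtain b where b: "?N (Suc k) \<subseteq> plus_set (?N k)"
        "internal_direct_sum (lin.span (plus_set (?N k))) (J \<inter> lin.span (plus_set (?N k)))
          (lin.span (?N (Suc k)))"
      using step[OF IH(1,2) k] by metis
    then have "finite (?N (Suc k))"
      using finite_plus_set[OF IH(1)] finite_subset by blast
    moreover have "?N (Suc k) \<subseteq> monomials (Suc k)"
      using b(1) plus_set_mono[OF IH(2)] by (simp add: monomials_Suc)
    ultimately show ?case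
      using direct_sum_forms_Suc[OF J IH(2,3) b(2,1)] by simp
  qed
  have part: "?N (Suc k) \<subseteq> plus_set (?N k) \<and> Bs ! k = border_basis_part J ?N (Suc k)"
    if k: "k < s" for k
  proof -
    have inv: "finite (?N k)" "?N k \<subseteq> monomials k"
        "internal_direct_sum (forms (Suc k)) (graded_part J (Suc k)) (lin.span (?N (Suc k)))"
      using invariant[of k] invariant[of "Suc k"] k by auto
    obtain b where b: "?N (Suc k) \<subseteq> plus_set (?N k)"
        "Bs ! k = b ` (plus_set (?N k) - ?N (Suc k))"
        "\<And>m. m \<in> plus_set (?N k) - ?N (Suc k) \<Longrightarrow> b m - m \<in> lin.span (?N (Suc k))"
        "\<And>m. m \<in> plus_set (?N k) - ?N (Suc k) \<Longrightarrow> b m \<in> J"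
      using step[OF inv(1,2) k] by metis
    have "b m = m + psi J ?N (Suc k) m" if m: "m \<in> plus_set (?N k) - ?N (Suc k)" for m
    proof -
      have "m \<in> forms (Suc k)"
        using m plus_set_mono[OF inv(2)] by (auto simp: forms_def monomials_Suc intro: lin.span_base)
      moreover have "lin.span (?N (Suc k)) \<subseteq> forms (Suc k)"
        using invariant[of "Suc k"] k by (simp add: forms_def lin.span_mono)
      ultimately have "m + (b m - m) \<in> graded_part J (Suc k)"
        using b(3,4)[OF m] unfolding graded_part_def forms_def
        by (intro IntI lin.span_add) auto
      then have "psi J ?N (Suc k) m = b m - m"
        by (intro psi_eq[where N = ?N, OF inv(3) J b(3)[OF m]])
      then show ?thesis
        by simp
    qed
    then show ?thesis
      using b(1,2) by (simp add: border_basis_part_def border_def)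
  qed
  have complement: "is_complement J s ?N"
    unfolding is_complement_def
  proof (intro conjI ballI)
    show "?N 0 = {1}"
      by (rule run(3))
    fix k
    assume "k \<in> {1..s}"
    then obtain k' where "k = Suc k'" "k' < s"
      by (cases k) auto
    then show "?N k \<subseteq> monomials k" "?N k \<subseteq> plus_set (?N (k - 1))"
        "internal_direct_sum (forms k) (graded_part J k) (lin.span (?N k))"
      using invariant[of k] part[of k'] by auto
  qed
  have parts: "Bs ! (k - 1) = border_basis_part J ?N k" if "k \<in> {1..s}" for k
    using that part[of "k - 1"] by auto
  have "set Bs = (\<lambda>k. Bs ! (k - 1)) ` {1..s}"
    unfolding set_conv_nth run(2) image_def
    by (force intro: bexI[of _ "Suc _"])
  then have "\<Union> (set Bs) = border_basis J s ?N"
    using parts by (simp add: border_basis_def)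
  then show ?thesis
    using run(1,2) complement parts by simp
qed

end
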